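(* Let $r\in\mathbb{N}$, $n\in\mathbb{Z}_+$ and $x\in\mathbb{Z}_p$. Then $$(1-q)^n\beta_{n,q}^{(0,r)}(x)=\sum_{l=0}^n\binom nl(-1)^l q^{lx}\,\frac{\binom{l-1}{r}}{\binom{l-1}{r}_q}\,\frac{r!}{[r]_q!}.$$
   Context: $p$ is a fixed prime, $\mathbb{N}=\{1,2,\dots\}$, $\mathbb{Z}_+=\mathbb{N}\cup\{0\}$, and $\mathbb{C}_p$ is the completion of an algebraic closure of $\mathbb{Q}_p$, with $|p|_p=p^{-1}$. $q\in\mathbb{C}_p$ satisfies $|1-q|_p<1$ and is not a root of unity. For $x\in\mathbb{Z}_p$, $q^x=\sum_{k\ge0}\binom xk(q-1)^k$ and $[x]_q=\frac{1-q^x}{1-q}$; $0^0=1$. $[r]_q!=[r]_q[r-1]_q\cdots[1]_q$, $\binom{m}{r}_q=\frac{[m]_q[m-1]_q\cdots[m-r+1]_q}{[r]_q!}$ and $\binom mr=\frac{m(m-1)\cdots(m-r+1)}{r!}$. The expression $\frac{\binom mr}{\binom mr_q}\frac{r!}{[r]_q!}$ means $\prod_{j=1}^r\frac{m-j+1}{[m-j+1]_q}$, where a factor $\frac{0}{[0]_q}$ is read as its limiting value $\frac{q-1}{\log q}$ ($\log$ the $p$-adic logarithm). The $p$-adic $q$-integral is $\int_{\mathbb{Z}_p}g(x)\,d\mu_q(x)=\lim_{N\to\infty}\frac{1}{[p^N]_q}\sum_{x=0}^{p^N-1}g(x)q^x$ (when the limit exists); multiple integrals are iterated. The polynomials $\beta_{n,q}^{(0,r)}(x)$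 are $$\beta_{n,q}^{(0,r)}(x)=\int_{\mathbb{Z}_p}\cdots\int_{\mathbb{Z}_p}[x+x_1+\cdots+x_r]_q^n\,q^{-2x_1-3x_2-\cdots-(r+1)x_r}\,d\mu_q(x_1)\cdots d\mu_q(x_r)\quad(r\text{ integrals}).$$ *)

theory Defs
  imports "HOL-Analysis.Analysis" "HOL-Computational_Algebra.Polynomial"
begin

text \<open>
  The field of \<open>p\<close>-adic complex numbers is not available in the library.  It is described here
  as a complete ultrametric field in which the closure of the rationals is the field of \<open>p\<close>-adic
  numbers (the normalisation of the absolute value at \<open>p\<close> forces its restriction to the
  rationals to be the \<open>p\<close>-adic one), the elements algebraic over that closure form an algebraic
  closure of it, and these elements are dense.  This determines the field up to isometric
  isomorphism.  The absolute value is the distance to \<open>0\<close> in the metric of class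
  \<^class>\<open>complete_space\<close>, so that limits, series and topological closure are those of the
  library.  (The library's \<open>norm\<close> is tied to real vector spaces.)
\<close>

definition pabs :: "'a::{field_char_0, complete_space} \<Rightarrow> real"
  where "pabs x = dist x 0"

definition Qp :: "'a::{field_char_0, complete_space} set"
  where "Qp = closure (range of_rat)"

definition Zp :: "'a::{field_char_0, complete_space} set"
  where "Zp = {x \<in> Qp. pabs x \<le> 1}"

definition Qp_bar :: "'a::{field_char_0, complete_space} set"
  where "Qp_bar = {x. \<exists>f. f \<noteq> 0 \<and> (\<forall>i. coeff f i \<in> Qp) \<and> poly f x = 0}"

locale padic_complex_field =
  fixes T :: "'a::{field_char_0, complete_space} itself" and p :: nat
  assumes prime_p: "prime p"
    and dist_eq_pabs: "\<And>x y :: 'a. dist x y = pabs (x - y)"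
    and pabs_mult: "\<And>x y :: 'a. pabs (x * y) = pabs x * pabs y"
    and pabs_add_le_max: "\<And>x y :: 'a. pabs (x + y) \<le> max (pabs x) (pabs y)"
    and pabs_p: "pabs (of_nat p :: 'a) = 1 / real p"
    and Qp_bar_alg_closed: "\<And>f :: 'a poly. \<lbrakk>\<forall>i. coeff f i \<in> Qp_bar; degree f > 0\<rbrakk>
          \<Longrightarrow> \<exists>x\<in>Qp_bar. poly f x = 0"
    and Qp_bar_dense: "closure (Qp_bar :: 'a set) = UNIV"

definition qpow :: "'a \<Rightarrow> 'a \<Rightarrow> 'a::{field_char_0, complete_space}"
  where "qpow q x = (\<Sum>k. (x gchoose k) * (q - 1) ^ k)"

definition qnum :: "'a \<Rightarrow> 'a \<Rightarrow> 'a::{field_char_0, complete_space}"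
  where "qnum q x = (1 - qpow q x) / (1 - q)"

definition padic_log :: "'a \<Rightarrow> 'a::{field_char_0, complete_space}"
  where "padic_log z = (\<Sum>k. (-1) ^ k * (z - 1) ^ Suc k / of_nat (Suc k))"

definition q_sums :: "nat \<Rightarrow> 'a \<Rightarrow> ('a \<Rightarrow> 'a) \<Rightarrow> nat
    \<Rightarrow> 'a::{field_char_0, complete_space}"
  where "q_sums p q g N = 1 / qnum q (of_nat (p ^ N)) *
           (\<Sum>x = 0..<p ^ N. g (of_nat x) * qpow q (of_nat x))"

definition q_integrable :: "nat \<Rightarrow> 'a::{field_char_0, complete_space} \<Rightarrow> ('a \<Rightarrow> 'a)
    \<Rightarrow> bool"
  where "q_integrable p q g \<longleftrightarrow> convergent (q_sums p q g)"

definition q_integral :: "nat \<Rightarrow> 'a \<Rightarrow> ('a \<Rightarrow> 'a)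
    \<Rightarrow> 'a::{field_char_0, complete_space}"
  where "q_integral p q g = lim (q_sums p q g)"

text \<open>
  The integrand of an \<open>r\<close>-fold integral is a function of \<open>X\<close>, of which only the values
  \<open>X 1, \<dots>, X r\<close> matter.  Integration over \<open>X 1\<close> is innermost.
\<close>

primrec iter_q_integral :: "nat \<Rightarrow> 'a \<Rightarrow> nat \<Rightarrow> ((nat \<Rightarrow> 'a) \<Rightarrow> 'a)
    \<Rightarrow> 'a::{field_char_0, complete_space}" where
  "iter_q_integral p q 0 g = g (\<lambda>_. 0)"
| "iter_q_integral p q (Suc r) g =
     q_integral p q (\<lambda>y. iter_q_integral p q r (\<lambda>X. g (X(Suc r := y))))"

text \<open>All limits occurring in the iterated integral exist.\<close>

primrec iter_q_integrable :: "nat \<Rightarrow> 'a::{field_char_0, complete_space} \<Rightarrow> nat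
    \<Rightarrow> ((nat \<Rightarrow> 'a) \<Rightarrow> 'a) \<Rightarrow> bool" where
  "iter_q_integrable p q 0 g \<longleftrightarrow> True"
| "iter_q_integrable p q (Suc r) g \<longleftrightarrow>
     (\<forall>y\<in>Zp. iter_q_integrable p q r (\<lambda>X. g (X(Suc r := y)))) \<and>
     q_integrable p q (\<lambda>y. iter_q_integral p q r (\<lambda>X. g (X(Suc r := y))))"

definition beta_integrand :: "'a \<Rightarrow> nat \<Rightarrow> nat \<Rightarrow> 'a \<Rightarrow> (nat \<Rightarrow> 'a)
    \<Rightarrow> 'a::{field_char_0, complete_space}"
  where "beta_integrand q n r x X =
           qnum q (x + (\<Sum>j = 1..r. X j)) ^ n * qpow q (- (\<Sum>j = 1..r. of_nat (j + 1) * X j))"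

definition beta0 :: "nat \<Rightarrow> 'a \<Rightarrow> nat \<Rightarrow> nat \<Rightarrow> 'a
    \<Rightarrow> 'a::{field_char_0, complete_space}"
  where "beta0 p q n r x = iter_q_integral p q r (beta_integrand q n r x)"

text \<open>
  \<open>binom_ratio q m r\<close> is the expression
  \<open>(binom m r / binom\<^sub>q m r) * (r! / [r]\<^sub>q!)\<close>, a product of quotients \<open>k / [k]\<^sub>q\<close> in which
  \<open>0 / [0]\<^sub>q\<close> is read as the limiting value \<open>(q - 1) / log q\<close>.
\<close>

definition num_div_qnum :: "'a \<Rightarrow> int \<Rightarrow> 'a::{field_char_0, complete_space}"
  where "num_div_qnum q k =
           (if k = 0 then (q - 1) / padic_log q else of_int k / qnum q (of_int k))"

definition binom_ratio :: "'a \<Rightarrow> int \<Rightarrow> nat \<Rightarrow> 'a::{field_char_0, complete_space}"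
  where "binom_ratio q m r = (\<Prod>j = 1..r. num_div_qnum q (m - int j + 1))"

end

theory Submission
  imports Defs "HOL-Number_Theory.Cong"
begin

text \<open>
  Expanding the power of the \<open>q\<close>-number binomially and using \<open>q\<^bsup>a+b\<^esup> = q\<^bsup>a\<^esup> q\<^bsup>b\<^esup>\<close> on the \<open>p\<close>-adic
  integers turns the integrand into a finite sum over \<open>l\<close> of products of exponentials, one factor
  \<open>q\<^bsup>(l-j-1)y\<^esup>\<close> for each variable \<open>y = X j\<close> (\<open>beta_integrand_exponential_sum\<close>).  The variables therefore
  separate, and everything reduces to the single integral of \<open>q\<^bsup>(k-1)y\<^esup>\<close> with \<open>k = l - j\<close>.  The weight
  \<open>q\<^bsup>y\<^esup>\<close> in the definition of the integral raises the exponent to \<open>ky\<close>, so that the approximating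
  sums are geometric.

  For \<open>k \<noteq> 0\<close> they equal \<open>(1-q)/(1-q\<^bsup>k\<^esup>)\<close> times \<open>(1-Q\<^bsup>k\<^esup>)/(1-Q)\<close> with \<open>Q\<close> the power of \<open>q\<close> with exponent
  \<open>p\<^bsup>N\<^esup>\<close>.  As \<open>Q\<close> tends to \<open>1\<close>, the limit is \<open>k(1-q)/(1-q\<^bsup>k\<^esup>)\<close>, which is \<open>k\<close> divided by its
  \<open>q\<close>-analogue.  For \<open>k = 0\<close> they equal \<open>(q-1)/((Q-1)/p\<^bsup>N\<^esup>)\<close>, and \<open>(Q-1)/p\<^bsup>N\<^esup>\<close> tends to \<open>log q\<close>
  (\<open>padic_log_limit\<close>).  This limit can only be inverted because \<open>log q \<noteq> 0\<close>, and that is where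
  \<open>q\<close> not being a root of unity enters in an essential way (\<open>padic_log_nonzero\<close>).

  The analytic input is elementary.  The law of exponents and the bound for binomial coefficients
  extend from the natural numbers to the \<open>p\<close>-adic integers by density (\<open>Zp_approx_of_nat\<close>).  Limits
  are exchanged with infinite series by dominated convergence, which in an ultrametric field needs
  only a null sequence as majorant (\<open>tendsto_suminf_dominated\<close>).
\<close>

context padic_complex_field
begin

section \<open>The absolute value\<close>

lemma pabs_nonneg [simp]: "0 \<le> pabs (x :: 'a)"
  by (simp add: pabs_def)

lemma pabs_zero [simp]: "pabs (0 :: 'a) = 0"
  by (simp add: pabs_def)

lemma pabs_eq_0_iff [simp]: "pabs (x :: 'a) = 0 \<longleftrightarrow> x = 0"
  by (simp add: pabs_def)

lemma pabs_pos_iff [simp]: "0 < pabs (x :: 'a) \<longleftrightarrow> x \<noteq> 0"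
  by (simp add: pabs_def)

lemma pabs_one [simp]: "pabs (1 :: 'a) = 1"
  using pabs_mult[of 1 "1 :: 'a"] by auto

lemma pabs_minus [simp]: "pabs (- x :: 'a) = pabs x"
proof -
  have "pabs (- 1 :: 'a) * pabs (- 1 :: 'a) = 1"
    using pabs_mult[of "- 1" "- 1 :: 'a"] by simp
  then have "pabs (- 1 :: 'a) = 1"
    by (metis pabs_nonneg power2_eq_1_iff power2_eq_square neg_0_le_iff_le not_one_le_zero)
  then show ?thesis
    using pabs_mult[of "- 1" x] by simp
qed

lemma pabs_diff_commute: "pabs (x - y :: 'a) = pabs (y - x)"
  by (metis minus_diff_eq pabs_minus)

lemma pabs_add_le: "pabs x \<le> B \<Longrightarrow> pabs y \<le> B \<Longrightarrow> pabs (x + y :: 'a) \<le> B"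
  using pabs_add_le_max[of x y] by linarith

lemma pabs_diff_le: "pabs x \<le> B \<Longrightarrow> pabs y \<le> B \<Longrightarrow> pabs (x - y :: 'a) \<le> B"
  using pabs_add_le[of x B "- y"] by simp

lemma pabs_power: "pabs (x ^ n :: 'a) = pabs x ^ n"
  by (induction n) (simp_all add: pabs_mult)

lemma pabs_divide: "pabs (x / y :: 'a) = pabs x / pabs y"
proof (cases "y = 0")
  case False
  then show ?thesis
    using pabs_mult[of "x / y" y] by (simp add: field_simps)
qed simp

lemma pabs_sum_le:
  assumes "\<And>i. i \<in> A \<Longrightarrow> pabs (f i :: 'a) \<le> B" "0 \<le> B"
  shows "pabs (sum f A) \<le> B"
  using assms by (induction A rule: infinite_finite_induct) (auto intro: pabs_add_le)

lemma pabs_add_eq_left: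
  assumes "pabs (y :: 'a) < pabs x"
  shows "pabs (x + y) = pabs x"
proof (rule antisym)
  show "pabs (x + y) \<le> pabs x"
    using assms by (intro pabs_add_le) auto
  show "pabs x \<le> pabs (x + y)"
    using pabs_add_le_max[of "x + y" "- y"] assms by auto
qed

lemma pabs_of_nat_le_1: "pabs (of_nat n :: 'a) \<le> 1"
  by (induction n) (auto intro: pabs_add_le)

lemma pabs_of_int_le_1: "pabs (of_int k :: 'a) \<le> 1"
  by (cases k rule: int_cases2) (simp_all add: pabs_of_nat_le_1)

lemma p_gt_1: "1 < p"
  using prime_p prime_gt_1_nat by blast

text \<open>
  By Bezout, \<open>1\<close> is a combination of \<open>p\<close> and \<open>m\<close>.  The term containing \<open>p\<close> has absolute value
  below \<open>1\<close>, so the ultrametric inequality forces the other one to have absolute value at least \<open>1\<close>.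
\<close>
lemma pabs_of_int_coprime:
  assumes "\<not> int p dvd m"
  shows "pabs (of_int m :: 'a) = 1"
proof (rule antisym[OF pabs_of_int_le_1])
  have "coprime (int p) m"
    using assms prime_p by (simp add: prime_imp_coprime)
  then obtain a b where "a * int p + b * m = 1"
    by (metis bezout_int coprime_imp_gcd_eq_1)
  then have "1 = (of_int (a * int p + b * m) :: 'a)"
    by simp
  also have "\<dots> = of_int a * of_nat p + of_int b * of_int m"
    by simp
  finally have "1 \<le> max (pabs (of_int a * of_nat p :: 'a)) (pabs (of_int b * of_int m :: 'a))"
    using pabs_add_le_max[of "of_int a * of_nat p" "of_int b * of_int m"] by simp
  moreover have "pabs (of_int a * of_nat p :: 'a) < 1"
  proof -
    have "pabs (of_int a * of_nat p :: 'a) \<le> 1 * (1 / real p)"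
      unfolding pabs_mult pabs_p by (intro mult_right_mono pabs_of_int_le_1) simp
    then show ?thesis
      using p_gt_1 by (smt (verit) divide_less_eq_1_pos mult_1 of_nat_1 of_nat_less_iff)
  qed
  moreover have "pabs (of_int b * of_int m :: 'a) \<le> pabs (of_int m :: 'a)"
    unfolding pabs_mult using pabs_of_int_le_1[of b] by (simp add: mult_left_le_one_le)
  ultimately show "1 \<le> pabs (of_int m :: 'a)"
    by linarith
qed

text \<open>
  Only the power of \<open>p\<close> in \<open>k\<close> contributes to the absolute value, and that power is at most \<open>k\<close>.  The
  bound controls the denominators in the logarithm series.
\<close>
lemma pabs_of_nat_ge:
  assumes "0 < k"
  shows "1 / real k \<le> pabs (of_nat k :: 'a)"
proof -
  obtain v m where k: "k = p ^ v * m" and m: "\<not> p dvd m"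
    using assms p_gt_1 multiplicity_decompose'[of k p]
    by (metis not_less_iff_gr_or_eq nat_dvd_1_iff_1)
  have "pabs (of_nat m :: 'a) = 1"
    using pabs_of_int_coprime[of "int m"] m by simp
  then have "pabs (of_nat k :: 'a) = 1 / real (p ^ v)"
    by (simp add: k pabs_mult pabs_power pabs_p power_one_over)
  moreover have "1 / real k \<le> 1 / real (p ^ v)"
    using assms p_gt_1 unfolding k by (intro divide_left_mono) (auto simp flip: of_nat_mult of_nat_power)
  ultimately show ?thesis
    by simp
qed

section \<open>Limits and series\<close>

text \<open>
  Convergence is measured by the absolute value; with its multiplicativity and the ultrametric
  inequality this yields the continuity of the field operations.
\<close>
lemma tendsto_iff_pabs:
  "(f \<longlongrightarrow> (l :: 'a)) F \<longleftrightarrow> ((\<lambda>x. pabs (f x - l)) \<longlongrightarrow> 0) F"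
  using tendsto_dist_iff[of f l F] by (simp only: dist_eq_pabs)

lemma tendsto_of_pabs_diff_le:
  assumes "(h \<longlongrightarrow> 0) F" "\<And>x. pabs (f x - (l :: 'a)) \<le> h x"
  shows "(f \<longlongrightarrow> l) F"
  unfolding tendsto_iff_pabs
  by (rule tendsto_sandwich[OF _ _ tendsto_const assms(1)]) (auto simp: assms(2))

lemma tendsto_pabs:
  assumes "(f \<longlongrightarrow> (l :: 'a)) F"
  shows "((\<lambda>x. pabs (f x)) \<longlongrightarrow> pabs l) F"
  unfolding pabs_def by (intro tendsto_dist assms tendsto_const)

lemma tendsto_padd:
  assumes "(f \<longlongrightarrow> (a :: 'a)) F" "(g \<longlongrightarrow> b) F"
  shows "((\<lambda>x. f x + g x) \<longlongrightarrow> a + b) F"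
proof -
  have "((\<lambda>x. pabs (f x - a) + pabs (g x - b)) \<longlongrightarrow> 0) F"
    using tendsto_add[OF assms[unfolded tendsto_iff_pabs]] by simp
  moreover have "pabs (f x + g x - (a + b)) \<le> pabs (f x - a) + pabs (g x - b)" for x
  proof -
    have "pabs (f x + g x - (a + b)) \<le> max (pabs (f x - a)) (pabs (g x - b))"
      using pabs_add_le_max[of "f x - a" "g x - b"] by (simp only: add_diff_add)
    also have "\<dots> \<le> pabs (f x - a) + pabs (g x - b)"
      by simp
    finally show ?thesis .
  qed
  ultimately show ?thesis
    by (rule tendsto_of_pabs_diff_le)
qed

lemma tendsto_pmult:
  assumes "(f \<longlongrightarrow> (a :: 'a)) F" "(g \<longlongrightarrow> b) F"
  shows "((\<lambda>x. f x * g x) \<longlongrightarrow> a * b) F"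
proof -
  have "((\<lambda>x. pabs (f x) * pabs (g x - b) + pabs (f x - a) * pabs b) \<longlongrightarrow> pabs a * 0 + 0 * pabs b) F"
    by (intro tendsto_add tendsto_mult tendsto_const tendsto_pabs assms(1) assms[unfolded tendsto_iff_pabs])
  then have "((\<lambda>x. pabs (f x) * pabs (g x - b) + pabs (f x - a) * pabs b) \<longlongrightarrow> 0) F"
    by simp
  moreover have "pabs (f x * g x - a * b) \<le> pabs (f x) * pabs (g x - b) + pabs (f x - a) * pabs b" for x
  proof -
    have "f x * g x - a * b = f x * (g x - b) + (f x - a) * b"
      by (simp add: algebra_simps)
    then have "pabs (f x * g x - a * b) \<le> max (pabs (f x * (g x - b))) (pabs ((f x - a) * b))"
      by (metis pabs_add_le_max)
    also have "\<dots> \<le> pabs (f x * (g x - b)) + pabs ((f x - a) * b)"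
      by simp
    finally show ?thesis
      by (simp add: pabs_mult)
  qed
  ultimately show ?thesis
    by (rule tendsto_of_pabs_diff_le)
qed

lemma tendsto_pminus: "(f \<longlongrightarrow> (a :: 'a)) F \<Longrightarrow> ((\<lambda>x. - f x) \<longlongrightarrow> - a) F"
  using tendsto_pmult[OF tendsto_const[of "- 1"], of f a F] by simp

lemma tendsto_pdiff:
  "(f \<longlongrightarrow> (a :: 'a)) F \<Longrightarrow> (g \<longlongrightarrow> b) F \<Longrightarrow> ((\<lambda>x. f x - g x) \<longlongrightarrow> a - b) F"
  using tendsto_padd[of f a F "\<lambda>x. - g x" "- b"] tendsto_pminus[of g b F] by simp

lemma tendsto_pinverse:
  assumes "(f \<longlongrightarrow> (a :: 'a)) F" "a \<noteq> 0"
  shows "((\<lambda>x. inverse (f x)) \<longlongrightarrow> inverse a) F"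
proof -
  have "((\<lambda>x. pabs (f x - a) / (pabs (f x) * pabs a)) \<longlongrightarrow> 0 / (pabs a * pabs a)) F"
    by (intro tendsto_divide tendsto_mult tendsto_const tendsto_pabs assms(1)
        assms(1)[unfolded tendsto_iff_pabs]) (use assms in auto)
  then have lim: "((\<lambda>x. pabs (f x - a) / (pabs (f x) * pabs a)) \<longlongrightarrow> 0) F"
    by simp
  have "eventually (\<lambda>x. pabs (f x) > 0) F"
    using tendsto_pabs[OF assms(1)] assms(2) by (intro order_tendstoD(1)) auto
  then have "eventually (\<lambda>x. pabs (f x - a) / (pabs (f x) * pabs a) = pabs (inverse (f x) - inverse a)) F"
  proof eventually_elim
    case (elim x)
    then have "inverse (f x) - inverse a = (a - f x) / (f x * a)"
      using assms(2) by (simp add: field_simps)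
    then show ?case
      by (simp add: pabs_divide pabs_mult pabs_diff_commute)
  qed
  with lim show ?thesis
    unfolding tendsto_iff_pabs by (rule Lim_transform_eventually)
qed

lemma tendsto_pdivide:
  "(f \<longlongrightarrow> (a :: 'a)) F \<Longrightarrow> (g \<longlongrightarrow> b) F \<Longrightarrow> b \<noteq> 0 \<Longrightarrow> ((\<lambda>x. f x / g x) \<longlongrightarrow> a / b) F"
  unfolding divide_inverse by (intro tendsto_pmult tendsto_pinverse)

lemma tendsto_psum:
  assumes "\<And>i. i \<in> A \<Longrightarrow> (f i \<longlongrightarrow> (l i :: 'a)) F"
  shows "((\<lambda>x. \<Sum>i\<in>A. f i x) \<longlongrightarrow> (\<Sum>i\<in>A. l i)) F"
  using assms by (induction A rule: infinite_finite_induct) (auto intro: tendsto_padd)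

lemma tendsto_ppower: "(f \<longlongrightarrow> (a :: 'a)) F \<Longrightarrow> ((\<lambda>x. f x ^ n) \<longlongrightarrow> a ^ n) F"
  by (induction n) (auto intro: tendsto_pmult)

text \<open>
  A block of consecutive terms is bounded by its largest term, so the partial sums are Cauchy as
  soon as the terms tend to \<open>0\<close>.
\<close>
lemma summable_of_pabs_tendsto_0:
  assumes "(\<lambda>k. pabs (f k :: 'a)) \<longlonglongrightarrow> 0"
  shows "summable f"
proof -
  have "Cauchy (\<lambda>n. \<Sum>k<n. f k)"
  proof (rule metric_CauchyI)
    fix e :: real assume "0 < e"
    then have "eventually (\<lambda>k. pabs (f k) < e / 2) sequentially"
      using assms by (intro order_tendstoD(2)) auto
    then obtain K where K: "\<And>k. k \<ge> K \<Longrightarrow> pabs (f k) < e / 2"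
      by (auto simp: eventually_sequentially)
    have *: "pabs ((\<Sum>k<n. f k) - (\<Sum>k<m. f k)) < e" if "K \<le> m" "m \<le> n" for m n
    proof -
      have "(\<Sum>k<n. f k) - (\<Sum>k<m. f k) = (\<Sum>k\<in>{m..<n}. f k)"
        using sum_diff_nat_ivl[of 0 m n f] that by (simp add: atLeast0LessThan)
      also have "pabs \<dots> \<le> e / 2"
        using K that \<open>0 < e\<close> by (intro pabs_sum_le) (auto intro: less_imp_le)
      finally show ?thesis
        using \<open>0 < e\<close> by simp
    qed
    have "dist (\<Sum>k<m. f k) (\<Sum>k<n. f k) < e" if "K \<le> m" "K \<le> n" for m n
      using *[of m n] *[of n m] that by (cases "m \<le> n") (auto simp: dist_eq_pabs pabs_diff_commute)
    then show "\<exists>M. \<forall>m\<ge>M. \<forall>n\<ge>M. dist (\<Sum>k<m. f k) (\<Sum>k<n. f k) < e"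
      by blast
  qed
  then show ?thesis
    unfolding summable_iff_convergent by (rule Cauchy_convergent)
qed

lemma pabs_suminf_tail_le:
  assumes "summable (f :: nat \<Rightarrow> 'a)" "\<And>k. k \<ge> K \<Longrightarrow> pabs (f k) \<le> B" "0 \<le> B"
  shows "pabs (suminf f - (\<Sum>k<K. f k)) \<le> B"
proof (rule tendsto_upperbound)
  show "(\<lambda>n. pabs ((\<Sum>k<n. f k) - (\<Sum>k<K. f k))) \<longlonglongrightarrow> pabs (suminf f - (\<Sum>k<K. f k))"
    by (intro tendsto_pabs tendsto_pdiff tendsto_const summable_LIMSEQ assms)
  show "\<forall>\<^sub>F n in sequentially. pabs ((\<Sum>k<n. f k) - (\<Sum>k<K. f k)) \<le> B"
    using eventually_ge_at_top[of K]
  proof eventually_elim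
    case (elim n)
    then have "(\<Sum>k<n. f k) - (\<Sum>k<K. f k) = (\<Sum>k\<in>{K..<n}. f k)"
      using sum_diff_nat_ivl[of 0 K n f] by (simp add: atLeast0LessThan)
    also have "pabs \<dots> \<le> B"
      using assms by (intro pabs_sum_le) auto
    finally show ?case .
  qed
qed simp

text \<open>
  Beyond a suitable index \<open>K\<close> all tails are small, uniformly in \<open>N\<close>, because a tail is bounded by
  its largest term.  The first \<open>K\<close> terms converge as a finite sum.  Unlike in the Archimedean
  Tannery theorem, \<open>M\<close> need not be summable.
\<close>
lemma tendsto_suminf_dominated:
  assumes lim: "\<And>k. (\<lambda>N. f N k :: 'a) \<longlonglongrightarrow> g k"
    and bound: "\<And>N k. pabs (f N k) \<le> M k"
    and M: "M \<longlonglongrightarrow> 0"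
  shows "(\<lambda>N. suminf (f N)) \<longlonglongrightarrow> suminf g"
proof (rule metric_LIMSEQ_I)
  fix e :: real assume e: "0 < e"
  have bound_g: "pabs (g k) \<le> M k" for k
    by (rule tendsto_upperbound[OF tendsto_pabs[OF lim]]) (auto simp: bound)
  have summable: "summable h" if "\<And>k. pabs (h k) \<le> M k" for h :: "nat \<Rightarrow> 'a"
    by (intro summable_of_pabs_tendsto_0 tendsto_sandwich[OF _ _ tendsto_const M]) (auto simp: that)
  obtain K where K: "\<And>k. k \<ge> K \<Longrightarrow> M k < e / 2"
    using order_tendstoD(2)[OF M, of "e / 2"] e by (auto simp: eventually_sequentially)
  have tail: "pabs (suminf h - (\<Sum>k<K. h k)) \<le> e / 2" if "\<And>k. pabs (h k) \<le> M k"
    for h :: "nat \<Rightarrow> 'a"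
  proof (intro pabs_suminf_tail_le summable that)
    show "pabs (h k) \<le> e / 2" if "k \<ge> K" for k
      using K[OF that] \<open>\<And>k. pabs (h k) \<le> M k\<close>[of k] by linarith
  qed (use e in auto)
  have "(\<lambda>N. \<Sum>k<K. f N k) \<longlonglongrightarrow> (\<Sum>k<K. g k)"
    by (intro tendsto_psum lim)
  from metric_LIMSEQ_D[OF this, of "e / 2"] obtain N0 where N0: "\<And>N. N \<ge> N0 \<Longrightarrow> pabs ((\<Sum>k<K. f N k) - (\<Sum>k<K. g k)) < e / 2"
    using e by (auto simp: dist_eq_pabs)
  have "dist (suminf (f N)) (suminf g) < e" if "N \<ge> N0" for N
  proof -
    have "suminf (f N) - suminf g = (suminf (f N) - (\<Sum>k<K. f N k)) +
        ((\<Sum>k<K. f N k) - (\<Sum>k<K. g k)) - (suminf g - (\<Sum>k<K. g k))"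
      by simp
    also have "pabs \<dots> \<le> e / 2"
      using N0[OF that] by (intro pabs_diff_le[OF pabs_add_le] tail bound bound_g) auto
    finally show ?thesis
      using e by (simp add: dist_eq_pabs)
  qed
  then show "\<exists>no. \<forall>n\<ge>no. dist (suminf (f n)) (suminf g) < e"
    by blast
qed

section \<open>Density of the natural numbers in the \<open>p\<close>-adic integers\<close>

lemma pabs_of_int_le_of_dvd:
  assumes "int (p ^ N) dvd m"
  shows "pabs (of_int m :: 'a) \<le> (1 / real p) ^ N"
proof -
  from assms obtain c where "m = int (p ^ N) * c" ..
  then have "pabs (of_int m :: 'a) = (1 / real p) ^ N * pabs (of_int c :: 'a)"
    by (simp add: pabs_mult pabs_power pabs_p)
  also have "\<dots> \<le> (1 / real p) ^ N"
    using pabs_of_int_le_1 by (intro mult_left_le) auto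
  finally show ?thesis .
qed

lemma inverse_p_power_tendsto_0: "(\<lambda>N. (1 / real p) ^ N) \<longlonglongrightarrow> 0"
  using p_gt_1 by (intro LIMSEQ_power_zero) simp

text \<open>
  A rational number of absolute value at most \<open>1\<close> has, in lowest terms, a denominator prime to \<open>p\<close>.
  The denominator is thus invertible modulo \<open>p\<^bsup>N\<^esup>\<close>, and a natural number congruent to the quotient
  is the required approximation.
\<close>
lemma rat_approx_of_nat:
  assumes "pabs (of_rat r :: 'a) \<le> 1"
  shows "\<exists>m. pabs (of_rat r - of_nat m :: 'a) \<le> (1 / real p) ^ N"
proof -
  obtain a b where ab: "quotient_of r = (a, b)" by (cases "quotient_of r")
  then have b: "b > 0" and cop: "coprime a b" and r: "r = of_int a / of_int b"
    by (auto simp: quotient_of_denom_pos quotient_of_coprime quotient_of_div)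
  have r': "(of_rat r :: 'a) = of_int a / of_int b"
    by (simp add: r of_rat_divide)
  have pb: "\<not> int p dvd b"
  proof
    assume dvd: "int p dvd b"
    then have "\<not> int p dvd a"
      using cop p_gt_1 by (metis not_coprimeI of_nat_1 zdvd1_eq abs_of_nat less_irrefl nat_int nat_int_comparison(2))
    then have "pabs (of_int a :: 'a) = 1" by (rule pabs_of_int_coprime)
    moreover have "pabs (of_int b :: 'a) < 1"
      using pabs_of_int_le_of_dvd[of 1 b] dvd p_gt_1
      by (smt (verit) divide_less_eq_1_pos of_nat_1 of_nat_less_iff power_one_right)
    moreover have "0 < pabs (of_int b :: 'a)"
      using b by simp
    ultimately have "1 < pabs (of_rat r :: 'a)"
      by (simp only: r' pabs_divide less_divide_eq_1_pos)
    with assms show False by simp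
  qed
  then have "coprime b (int (p ^ N))"
    using prime_imp_coprime[of "int p" b] prime_p by (simp add: coprime_commute[of b])
  then obtain d where "[b * d = 1] (mod int (p ^ N))"
    using cong_solve_coprime_int by blast
  from cong_scalar_right[OF this, of a] obtain c where c: "[b * c = a] (mod int (p ^ N))"
    by (metis mult.assoc mult_1)
  define m where "m = nat (c mod int (p ^ N))"
  have m: "int m = c mod int (p ^ N)"
    using p_gt_1 by (simp add: m_def)
  have "[b * int m = a] (mod int (p ^ N))"
    unfolding m using c by (simp add: cong_def mod_mult_right_eq)
  then have "int (p ^ N) dvd a - b * int m"
    by (simp add: cong_iff_dvd_diff dvd_diff_commute)
  then have "pabs (of_int (a - b * int m) :: 'a) \<le> (1 / real p) ^ N"
    by (rule pabs_of_int_le_of_dvd)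
  moreover have "of_rat r - of_nat m = (of_int (a - b * int m) / of_int b :: 'a)"
    using b by (simp add: r' field_simps)
  ultimately have "pabs (of_rat r - of_nat m :: 'a) \<le> (1 / real p) ^ N"
    using pabs_of_int_coprime[OF pb] by (simp add: pabs_divide)
  then show ?thesis ..
qed

lemma Zp_approx_of_nat:
  assumes "x \<in> (Zp :: 'a set)"
  obtains s :: "nat \<Rightarrow> nat" where "(\<lambda>N. of_nat (s N)) \<longlonglongrightarrow> x"
proof -
  have "\<exists>m. pabs (of_nat m - x) \<le> (1 / real p) ^ N" for N
  proof -
    have pos: "(1 / real p) ^ N > 0" "(1 / real p) ^ N \<le> 1"
      using p_gt_1 by (auto intro!: power_le_one)
    obtain y where y: "y \<in> range of_rat" "dist y x < (1 / real p) ^ N"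
      using assms pos(1) unfolding Zp_def Qp_def closure_approachable by blast
    then obtain r where r: "y = of_rat r" by auto
    have yx: "pabs (y - x) \<le> (1 / real p) ^ N"
      using y by (simp add: dist_eq_pabs)
    then have "pabs ((y - x) + x) \<le> 1"
      using assms pos by (intro pabs_add_le) (auto simp: Zp_def)
    then obtain m where "pabs (y - of_nat m) \<le> (1 / real p) ^ N"
      using rat_approx_of_nat[of r N] by (auto simp: r)
    then have "pabs ((y - x) - (y - of_nat m)) \<le> (1 / real p) ^ N"
      using yx by (rule pabs_diff_le[rotated])
    then show ?thesis by auto
  qed
  then obtain s where s: "\<And>N. pabs (of_nat (s N) - x) \<le> (1 / real p) ^ N"
    by metis
  show ?thesis
    by (rule that) (rule tendsto_of_pabs_diff_le[OF inverse_p_power_tendsto_0 s])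
qed

lemma Zp_of_tendsto:
  assumes "(f \<longlongrightarrow> (x :: 'a)) sequentially" "\<And>N. f N \<in> Zp"
  shows "x \<in> Zp"
proof -
  have "x \<in> closure (range of_rat)"
    by (rule closed_sequentially[OF closed_closure _ assms(1)])
      (use assms(2) in \<open>simp add: Zp_def Qp_def\<close>)
  moreover have "pabs x \<le> 1"
    by (rule tendsto_upperbound[OF tendsto_pabs[OF assms(1)]]) (use assms(2) in \<open>auto simp: Zp_def\<close>)
  ultimately show ?thesis by (simp add: Zp_def Qp_def)
qed

lemma of_int_in_Zp [simp]: "of_int k \<in> (Zp :: 'a set)"
proof -
  have "of_int k = (of_rat (of_int k) :: 'a)" by simp
  then have "of_int k \<in> (Qp :: 'a set)"
    unfolding Qp_def by (metis closure_subset rangeI subsetD)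
  then show ?thesis by (simp add: Zp_def pabs_of_int_le_1)
qed

lemma of_nat_in_Zp [simp]: "of_nat k \<in> (Zp :: 'a set)"
  using of_int_in_Zp[of "int k"] by simp

lemma zero_in_Zp [simp]: "0 \<in> (Zp :: 'a set)"
  using of_nat_in_Zp[of 0] by simp

lemma Zp_add:
  assumes "x \<in> (Zp :: 'a set)" "y \<in> Zp"
  shows "x + y \<in> Zp"
proof -
  obtain s where s: "(\<lambda>N. of_nat (s N)) \<longlonglongrightarrow> x" by (rule Zp_approx_of_nat[OF assms(1)])
  obtain t where t: "(\<lambda>N. of_nat (t N)) \<longlonglongrightarrow> y" by (rule Zp_approx_of_nat[OF assms(2)])
  have "of_nat (s N) + of_nat (t N) \<in> (Zp :: 'a set)" for N
    using of_nat_in_Zp[of "s N + t N"] by simp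
  then show ?thesis
    by (rule Zp_of_tendsto[OF tendsto_padd[OF s t]])
qed

lemma Zp_of_int_mult:
  assumes "y \<in> (Zp :: 'a set)"
  shows "of_int k * y \<in> Zp"
proof -
  obtain t where t: "(\<lambda>N. of_nat (t N)) \<longlonglongrightarrow> y" by (rule Zp_approx_of_nat[OF assms])
  have "of_int k * of_nat (t N) \<in> (Zp :: 'a set)" for N
    using of_int_in_Zp[of "k * int (t N)"] by simp
  then show ?thesis
    by (rule Zp_of_tendsto[OF tendsto_pmult[OF tendsto_const t]])
qed

lemma Zp_sum: "(\<And>i. i \<in> A \<Longrightarrow> f i \<in> (Zp :: 'a set)) \<Longrightarrow> sum f A \<in> Zp"
  by (induction A rule: infinite_finite_induct) (auto intro: Zp_add)

section \<open>Binomial coefficients and powers of \<open>q\<close>\<close>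

lemma tendsto_gchoose:
  assumes "(f \<longlongrightarrow> (x :: 'a)) F"
  shows "((\<lambda>i. f i gchoose k) \<longlongrightarrow> x gchoose k) F"
proof (induction k)
  case (Suc k)
  have rec: "a gchoose Suc k = (a gchoose k) * (a - of_nat k) / of_nat (Suc k)" for a :: 'a
    using gbinomial_absorb_comp[of a k] gbinomial_absorption[of k a]
    by (simp add: field_simps del: of_nat_Suc)
  show ?case
    unfolding rec by (intro tendsto_pdivide tendsto_pmult tendsto_pdiff Suc assms tendsto_const)
      (simp del: of_nat_Suc)
qed simp

text \<open>
  For natural \<open>x\<close> the binomial coefficient is itself a natural number.  The bound passes to the
  closure because the generalized binomial coefficient is continuous.
\<close>
lemma pabs_gchoose_le_1:
  assumes "x \<in> (Zp :: 'a set)"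
  shows "pabs (x gchoose k) \<le> 1"
proof -
  obtain s where s: "(\<lambda>N. of_nat (s N)) \<longlonglongrightarrow> x" by (rule Zp_approx_of_nat[OF assms])
  have "pabs ((of_nat (s N) :: 'a) gchoose k) \<le> 1" for N
    unfolding binomial_gbinomial[symmetric] by (rule pabs_of_nat_le_1)
  then show ?thesis
    by (intro tendsto_upperbound[OF tendsto_pabs[OF tendsto_gchoose[OF s]]]) auto
qed

lemma of_nat_p_power_tendsto_0: "(\<lambda>N. of_nat (p ^ N) :: 'a) \<longlonglongrightarrow> 0"
  unfolding tendsto_iff_pabs using inverse_p_power_tendsto_0 by (simp add: pabs_power pabs_p)

lemma qpow_of_nat: "qpow q (of_nat n) = (q :: 'a) ^ n"
proof -
  have "qpow q (of_nat n) = (\<Sum>k\<le>n. (of_nat n gchoose k) * (q - 1) ^ k)"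
    unfolding qpow_def by (intro suminf_finite) (auto simp flip: binomial_gbinomial)
  also have "\<dots> = ((q - 1) + 1) ^ n"
    by (simp only: binomial_ring power_one mult_1_right binomial_gbinomial)
  finally show ?thesis by simp
qed

text \<open>
  Dividing the binomial expansion by \<open>P\<close> termwise, via the absorption identity, leaves coefficients
  whose only denominators are \<open>k + 1\<close>.  With \<open>P\<close> a high power of \<open>p\<close>, this is a deformation of the
  logarithm series.
\<close>
lemma power_minus_one_div_expansion:
  fixes w :: 'a
  assumes "P > 0"
  shows "((1 + w) ^ P - 1) / of_nat P =
    (\<Sum>k<P. of_nat ((P - 1) choose k) * w ^ Suc k / of_nat (Suc k))"
proof -
  obtain R where P: "P = Suc R" using assms gr0_implies_Suc by blast
  have "(1 + w) ^ P = (\<Sum>k\<le>P. of_nat (P choose k) * w ^ k)"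
    using binomial_ring[of w 1 P] by (simp add: add.commute)
  also have "\<dots> = 1 + (\<Sum>k<P. of_nat (P choose Suc k) * w ^ Suc k)"
    by (simp add: P sum.atMost_Suc_shift lessThan_Suc_atMost del: binomial_Suc_Suc sum.atMost_Suc)
  also have "(\<Sum>k<P. of_nat (P choose Suc k) * w ^ Suc k) =
      (\<Sum>k<P. of_nat P * (of_nat ((P - 1) choose k) * w ^ Suc k / of_nat (Suc k)))"
  proof (rule sum.cong)
    fix k
    have "of_nat (Suc k * (P choose Suc k)) = (of_nat (P * ((P - 1) choose k)) :: 'a)"
      unfolding P by (simp only: Suc_times_binomial_eq diff_Suc_1 mult.commute)
    then have "of_nat (P choose Suc k) * of_nat (Suc k) = (of_nat P * of_nat ((P - 1) choose k) :: 'a)"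
      by (simp only: of_nat_mult mult.commute)
    then have "of_nat (P choose Suc k) = (of_nat P * of_nat ((P - 1) choose k) / of_nat (Suc k) :: 'a)"
      by (subst nonzero_eq_divide_eq) (simp_all del: of_nat_Suc binomial_Suc_Suc)
    then show "of_nat (P choose Suc k) * w ^ Suc k =
      of_nat P * (of_nat ((P - 1) choose k) * w ^ Suc k / of_nat (Suc k))"
      by (simp del: of_nat_Suc binomial_Suc_Suc)
  qed simp
  also have "\<dots> = of_nat P * (\<Sum>k<P. of_nat ((P - 1) choose k) * w ^ Suc k / of_nat (Suc k))"
    by (rule sum_distrib_left[symmetric])
  finally show ?thesis
    using assms by (simp del: power_Suc of_nat_Suc)
qed

lemma pabs_binomial_term_le:
  "pabs (of_nat (m choose k) * w ^ Suc k / of_nat (Suc k) :: 'a) \<le> real (Suc k) * pabs w ^ Suc k"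
proof -
  have "pabs (of_nat (m choose k) * w ^ Suc k / of_nat (Suc k) :: 'a) \<le>
      1 * pabs w ^ Suc k / (1 / real (Suc k))"
    unfolding pabs_divide pabs_mult pabs_power
    by (intro frac_le mult_right_mono pabs_of_nat_le_1 pabs_of_nat_ge) auto
  then show ?thesis by (simp add: mult.commute)
qed

text \<open>
  For small \<open>w\<close> the linear term of the expansion strictly dominates all others, uniformly in \<open>P\<close>.
  This keeps the quotients that converge to the logarithm away from \<open>0\<close>.
\<close>
lemma pabs_power_minus_one_div:
  fixes w :: 'a
  assumes "pabs w < 1 / 2" "P > 0"
  shows "pabs (((1 + w) ^ P - 1) / of_nat P) = pabs w"
proof (cases "w = 0")
  case False
  let ?t = "\<lambda>k. of_nat ((P - 1) choose k) * w ^ Suc k / of_nat (Suc k)"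
  obtain R where P: "P = Suc R" using assms gr0_implies_Suc by blast
  have "((1 + w) ^ P - 1) / of_nat P = w + (\<Sum>k<R. ?t (Suc k))"
    unfolding power_minus_one_div_expansion[OF assms(2)]
    by (subst P, subst sum.lessThan_Suc_shift) simp
  moreover have "pabs (\<Sum>k<R. ?t (Suc k)) \<le> 2 * pabs w ^ 2"
  proof (rule pabs_sum_le)
    fix k
    \<comment> \<open>The estimate \<open>(k + 2) |w|\<^sup>k \<le> 2\<close> for \<open>|w| \<le> 1 / 2\<close> leaves a factor \<open>|w|\<^sup>2\<close> over.\<close>
    have "real (Suc (Suc k)) \<le> 2 * 2 ^ k"
      by (induction k) auto
    then have "real (Suc (Suc k)) * pabs w ^ k \<le> 2 * 2 ^ k * (1 / 2) ^ k"
      using assms(1) by (intro mult_mono power_mono) auto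
    then have "real (Suc (Suc k)) * pabs w ^ k \<le> 2"
      by (simp add: power_one_over)
    then have "real (Suc (Suc k)) * pabs w ^ k * pabs w ^ 2 \<le> 2 * pabs w ^ 2"
      by (intro mult_right_mono) auto
    then show "pabs (?t (Suc k)) \<le> 2 * pabs w ^ 2"
      using pabs_binomial_term_le[of "P - 1" "Suc k" w] by (simp add: power2_eq_square mult_ac)
  qed simp
  moreover have "2 * pabs w ^ 2 < pabs w"
    using assms(1) False by (simp add: power2_eq_square)
  ultimately show ?thesis
    using pabs_add_eq_left by simp
qed simp

context
  fixes q :: 'a
  assumes q_near_1: "pabs (1 - q) < 1"
begin

lemma pabs_q_minus_1: "pabs (q - 1) < 1"
  using q_near_1 by (simp add: pabs_diff_commute)

lemma tendsto_qpow:
  assumes "f \<longlonglongrightarrow> x" "\<And>N. f N \<in> Zp"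
  shows "(\<lambda>N. qpow q (f N)) \<longlonglongrightarrow> qpow q x"
  unfolding qpow_def
proof (rule tendsto_suminf_dominated)
  show "(\<lambda>N. (f N gchoose k) * (q - 1) ^ k) \<longlonglongrightarrow> (x gchoose k) * (q - 1) ^ k" for k
    by (intro tendsto_pmult tendsto_gchoose assms tendsto_const)
  show "pabs ((f N gchoose k) * (q - 1) ^ k) \<le> pabs (q - 1) ^ k" for N k
    using pabs_gchoose_le_1[OF assms(2)] by (simp add: pabs_mult pabs_power mult_left_le_one_le)
  show "(\<lambda>k. pabs (q - 1) ^ k) \<longlonglongrightarrow> 0"
    using pabs_q_minus_1 by (intro LIMSEQ_power_zero) simp
qed

text \<open>
  For natural exponents this is the law for ordinary powers; density of the natural numbers and
  continuity of both sides give the general case.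
\<close>
lemma qpow_add:
  assumes "x \<in> Zp" "y \<in> Zp"
  shows "qpow q (x + y) = qpow q x * qpow q y"
proof -
  obtain s where s: "(\<lambda>N. of_nat (s N)) \<longlonglongrightarrow> x" by (rule Zp_approx_of_nat[OF assms(1)])
  obtain t where t: "(\<lambda>N. of_nat (t N)) \<longlonglongrightarrow> y" by (rule Zp_approx_of_nat[OF assms(2)])
  have "qpow q (of_nat (s N) + of_nat (t N)) = qpow q (of_nat (s N)) * qpow q (of_nat (t N))" for N
    unfolding of_nat_add[symmetric] qpow_of_nat power_add ..
  moreover have "(\<lambda>N. qpow q (of_nat (s N) + of_nat (t N))) \<longlonglongrightarrow> qpow q (x + y)"
    by (intro tendsto_qpow tendsto_padd s t Zp_add of_nat_in_Zp)
  moreover have "(\<lambda>N. qpow q (of_nat (s N)) * qpow q (of_nat (t N))) \<longlonglongrightarrow> qpow q x * qpow q y"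
    by (intro tendsto_qpow tendsto_pmult s t of_nat_in_Zp)
  ultimately show ?thesis
    by (simp add: LIMSEQ_unique)
qed

lemma qpow_zero [simp]: "qpow q 0 = 1"
  using qpow_of_nat[of q 0] by simp

lemma qpow_mult_qpow_minus:
  assumes "x \<in> Zp"
  shows "qpow q x * qpow q (- x) = 1"
  using qpow_add[OF assms, of "- x"] Zp_of_int_mult[OF assms, of "- 1"] by simp

lemma qpow_nonzero: "x \<in> Zp \<Longrightarrow> qpow q x \<noteq> 0"
  using qpow_mult_qpow_minus by fastforce

lemma qpow_of_nat_mult:
  assumes "x \<in> Zp"
  shows "qpow q (of_nat n * x) = qpow q x ^ n"
proof (induction n)
  case (Suc n)
  have "of_nat n * x \<in> Zp"
    using Zp_of_int_mult[OF assms, of "int n"] by simp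
  then show ?case
    using assms Suc by (simp add: distrib_right qpow_add)
qed simp

lemma qpow_of_int_mult:
  assumes "x \<in> Zp"
  shows "qpow q (of_int k * x) = qpow q x powi k"
proof (cases k rule: int_cases2)
  case (nonneg n)
  then show ?thesis by (simp add: qpow_of_nat_mult assms)
next
  case (nonpos n)
  have "qpow q (- (of_nat n * x)) = inverse (qpow q (of_nat n * x))"
    using qpow_mult_qpow_minus[of "of_nat n * x"] Zp_of_int_mult[OF assms, of "int n"]
    by (simp add: inverse_unique)
  then show ?thesis
    by (simp add: nonpos qpow_of_nat_mult assms power_int_minus)
qed

lemma qpow_of_int: "qpow q (of_int k) = q powi k"
  using qpow_of_int_mult[OF of_nat_in_Zp[of 1], of k] qpow_of_nat[of q 1] by simp

lemma qpow_sum: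
  "(\<And>i. i \<in> A \<Longrightarrow> f i \<in> Zp) \<Longrightarrow> qpow q (sum f A) = (\<Prod>i\<in>A. qpow q (f i))"
  by (induction A rule: infinite_finite_induct) (auto simp: qpow_add Zp_sum)

lemma q_nonzero: "q \<noteq> 0"
  using q_near_1 by auto

lemma q_power_p_power_tendsto_1: "(\<lambda>N. q ^ (p ^ N)) \<longlonglongrightarrow> 1"
  using tendsto_qpow[OF of_nat_p_power_tendsto_0 of_nat_in_Zp] by (simp only: qpow_of_nat qpow_zero)

text \<open>
  In the expansion of \<open>((1 + (q-1))\<^bsup>P\<^esup> - 1) / P\<close> with \<open>P = p\<^bsup>N\<^esup>\<close>, the binomial coefficient
  \<open>P - 1\<close> over \<open>k\<close> tends to \<open>-1\<close> over \<open>k\<close>, that is to \<open>(-1)\<^sup>k\<close>, since \<open>p\<^bsup>N\<^esup>\<close> tends to \<open>0\<close>.  The terms are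
  dominated by \<open>(k+1)|q-1|\<^bsup>k+1\<^esup>\<close> independently of \<open>N\<close>.
\<close>
lemma padic_log_limit: "(\<lambda>N. (q ^ (p ^ N) - 1) / of_nat (p ^ N)) \<longlonglongrightarrow> padic_log q"
proof -
  let ?t = "\<lambda>N k. of_nat ((p ^ N - 1) choose k) * (q - 1) ^ Suc k / of_nat (Suc k)"
  have p: "p ^ N > 0" for N using p_gt_1 by simp
  have "(\<lambda>N. suminf (?t N)) \<longlonglongrightarrow> padic_log q"
    unfolding padic_log_def
  proof (rule tendsto_suminf_dominated)
    fix k
    have "of_nat (p ^ N - 1) = (of_nat (p ^ N) - 1 :: 'a)" for N
      using p[of N] by (subst of_nat_diff) auto
    then have "(\<lambda>N. of_nat (p ^ N - 1) :: 'a) \<longlonglongrightarrow> - 1"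
      using tendsto_pdiff[OF of_nat_p_power_tendsto_0 tendsto_const[of 1]] by simp
    moreover have "((- 1 :: 'a) gchoose k) = (- 1) ^ k"
      using gbinomial_minus[of "1 :: 'a" k] by (simp flip: binomial_gbinomial)
    ultimately have "(\<lambda>N. of_nat ((p ^ N - 1) choose k) :: 'a) \<longlonglongrightarrow> (- 1) ^ k"
      unfolding binomial_gbinomial by (metis tendsto_gchoose)
    then show "(\<lambda>N. ?t N k) \<longlonglongrightarrow> (- 1) ^ k * (q - 1) ^ Suc k / of_nat (Suc k)"
      by (intro tendsto_pmult tendsto_pdivide tendsto_const of_nat_neq_0)
    show "(\<lambda>k. real (Suc k) * pabs (q - 1) ^ Suc k) \<longlonglongrightarrow> 0"
      using LIMSEQ_Suc[OF powser_times_n_limit_0[of "pabs (q - 1)"]] pabs_q_minus_1 by simp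
  qed (rule pabs_binomial_term_le)
  \<comment> \<open>The binomial coefficients vanish for \<open>k \<ge> p ^ N\<close>, so the series is the finite expansion.\<close>
  moreover have "suminf (?t N) = (q ^ (p ^ N) - 1) / of_nat (p ^ N)" for N
  proof -
    have "suminf (?t N) = (\<Sum>k<p ^ N. ?t N k)"
    proof (intro suminf_finite)
      fix k assume "k \<notin> {..<p ^ N}"
      then have "p ^ N - 1 < k"
        using p[of N] unfolding lessThan_iff by linarith
      then show "?t N k = 0"
        by (simp add: binomial_eq_0)
    qed simp
    also have "\<dots> = ((1 + (q - 1)) ^ (p ^ N) - 1) / of_nat (p ^ N)"
      by (rule power_minus_one_div_expansion[symmetric]) (rule p)
    finally show ?thesis by simp
  qed
  ultimately show ?thesis by simp
qed

context
  assumes q_not_root_of_unity: "\<forall>k\<ge>1. q ^ k \<noteq> 1"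
begin

text \<open>
  Some \<open>q ^ (p ^ M)\<close> is so close to \<open>1\<close> that raising it to further powers of \<open>p\<close> and dividing by these
  powers no longer changes the distance \<open>|w|\<close> to \<open>1\<close>.  Hence \<open>|log q|\<close> is \<open>|w|\<close> divided by the
  absolute value of \<open>p ^ M\<close>, and \<open>w \<noteq> 0\<close> because \<open>q\<close> is not a root of unity.
\<close>
lemma padic_log_nonzero: "padic_log q \<noteq> 0"
proof -
  obtain M where M: "pabs (q ^ (p ^ M) - 1) < 1 / 2"
    using metric_LIMSEQ_D[OF q_power_p_power_tendsto_1, of "1 / 2"] by (auto simp: dist_eq_pabs)
  define w where "w = q ^ (p ^ M) - 1"
  have w: "w \<noteq> 0" "pabs w < 1 / 2"
    using q_not_root_of_unity p_gt_1 M by (auto simp: w_def)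
  have "pabs ((q ^ (p ^ (N + M)) - 1) / of_nat (p ^ (N + M))) = pabs w / pabs (of_nat (p ^ M) :: 'a)" for N
  proof -
    have "(q ^ (p ^ (N + M)) - 1) / of_nat (p ^ (N + M)) =
        ((1 + w) ^ (p ^ N) - 1) / of_nat (p ^ N) / of_nat (p ^ M)"
      by (simp add: w_def power_add power_mult mult.commute flip: power_mult)
    moreover have "pabs (((1 + w) ^ (p ^ N) - 1) / of_nat (p ^ N)) = pabs w"
      using p_gt_1 by (intro pabs_power_minus_one_div w(2)) simp
    ultimately show ?thesis
      by (simp only: pabs_divide[of _ "of_nat (p ^ M)"])
  qed
  moreover have "(\<lambda>N. pabs ((q ^ (p ^ (N + M)) - 1) / of_nat (p ^ (N + M)))) \<longlonglongrightarrow> pabs (padic_log q)"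
    by (rule tendsto_pabs[OF LIMSEQ_ignore_initial_segment[OF padic_log_limit]])
  ultimately have "pabs (padic_log q) = pabs w / pabs (of_nat (p ^ M) :: 'a)"
    by (simp only: LIMSEQ_const_iff)
  then show ?thesis
    using w p_gt_1 by auto
qed

lemma q_powi_neq_1:
  assumes "k \<noteq> 0"
  shows "q powi k \<noteq> 1"
proof (cases k rule: int_cases2)
  case (nonneg n)
  then show ?thesis using assms q_not_root_of_unity by auto
next
  case (nonpos n)
  then show ?thesis using assms q_not_root_of_unity by (auto simp: power_int_minus)
qed

section \<open>Integrals of exponential sums\<close>

text \<open>
  The \<open>Q\<close>-analogue of \<open>k\<close> tends to \<open>k\<close> as \<open>Q\<close> tends to \<open>1\<close>: for \<open>k \<ge> 0\<close> it is a geometric sum, and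
  negative exponents are reduced to positive ones by extracting a power of \<open>Q\<close>.
\<close>
lemma tendsto_powi_quotient:
  assumes "Q \<longlonglongrightarrow> (1 :: 'a)" "\<And>N. Q N \<noteq> 1"
  shows "(\<lambda>N. (1 - Q N powi k) / (1 - Q N)) \<longlonglongrightarrow> of_int k"
proof -
  have nat: "(\<lambda>N. (1 - Q N ^ n) / (1 - Q N)) \<longlonglongrightarrow> of_nat n" for n
  proof -
    have "(1 - Q N ^ n) / (1 - Q N) = (\<Sum>i<n. Q N ^ i)" for N
      using assms(2)[of N] by (simp add: one_diff_power_eq)
    moreover have "(\<lambda>N. \<Sum>i<n. Q N ^ i) \<longlonglongrightarrow> (\<Sum>i<n. 1 ^ i)"
      by (intro tendsto_psum tendsto_ppower assms)
    ultimately show ?thesis by simp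
  qed
  show ?thesis
  proof (cases k rule: int_cases2)
    case (nonneg n)
    then show ?thesis using nat by simp
  next
    case (nonpos n)
    have "(\<lambda>N. - (inverse (Q N ^ n) * ((1 - Q N ^ n) / (1 - Q N)))) \<longlonglongrightarrow> - (inverse (1 ^ n) * of_nat n)"
      by (intro tendsto_pminus tendsto_pmult tendsto_pinverse tendsto_ppower nat assms) simp
    moreover have "eventually (\<lambda>N. pabs (Q N) > 0) sequentially"
      by (rule order_tendstoD(1)[OF tendsto_pabs[OF assms(1)]]) simp
    then have "eventually (\<lambda>N. - (inverse (Q N ^ n) * ((1 - Q N ^ n) / (1 - Q N))) =
        (1 - Q N powi k) / (1 - Q N)) sequentially"
    proof eventually_elim
      case (elim N)
      then show ?case
        using assms(2)[of N] by (simp add: nonpos power_int_minus field_simps)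
    qed
    ultimately show ?thesis
      using nonpos by (auto intro: Lim_transform_eventually)
  qed
qed

text \<open>
  The single integral to which everything reduces.  The exponent \<open>k - 1\<close> becomes \<open>k\<close> through the
  weight \<open>qpow q y\<close>, and the resulting geometric sum degenerates exactly for \<open>k = 0\<close>, where it has the
  value \<open>p ^ N\<close> and the logarithm appears.
\<close>
lemma q_sums_exponential:
  "q_sums p q (\<lambda>y. qpow q (of_int (k - 1) * y)) \<longlonglongrightarrow> num_div_qnum q k"
proof -
  have q: "q \<noteq> 1" and qN: "q ^ (p ^ N) \<noteq> 1" for N
    using q_not_root_of_unity[rule_format, of 1] q_not_root_of_unity p_gt_1 by auto
  have summand: "qpow q (of_int (k - 1) * of_nat y) * qpow q (of_nat y) = (q powi k) ^ y" for y
  proof -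
    have "qpow q (of_int (k - 1) * of_nat y) * qpow q (of_nat y) = (q ^ y) powi (k - 1) * q ^ y"
      by (simp only: qpow_of_int_mult[OF of_nat_in_Zp] qpow_of_nat)
    also have "\<dots> = (q ^ y) powi k"
      using q_nonzero by (simp add: power_int_diff)
    also have "\<dots> = (q powi k) ^ y"
      by (simp add: power_int_power power_int_power' mult.commute)
    finally show ?thesis .
  qed
  have sums: "q_sums p q (\<lambda>y. qpow q (of_int (k - 1) * y)) N =
      (1 - q) / (1 - q ^ (p ^ N)) * (\<Sum>y<p ^ N. (q powi k) ^ y)" for N
    unfolding q_sums_def summand unfolding qnum_def qpow_of_nat by (simp add: atLeast0LessThan)
  show ?thesis
  proof (cases "k = 0")
    case True
    have "(\<lambda>N. (q - 1) / ((q ^ (p ^ N) - 1) / of_nat (p ^ N))) \<longlonglongrightarrow> (q - 1) / padic_log q"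
      by (intro tendsto_pdivide tendsto_const padic_log_limit padic_log_nonzero)
    moreover have "(1 - q) / (1 - q ^ (p ^ N)) * (\<Sum>y<p ^ N. (q powi k) ^ y) =
        (q - 1) / ((q ^ (p ^ N) - 1) / of_nat (p ^ N))" for N
    proof -
      have "(1 - q) / (1 - q ^ (p ^ N)) = (q - 1) / (q ^ (p ^ N) - 1)"
        by (metis minus_diff_eq minus_divide_divide)
      then show ?thesis by (simp add: True)
    qed
    ultimately show ?thesis
      unfolding sums num_div_qnum_def using True by simp
  next
    case False
    note qk = q_powi_neq_1[OF False]
    have "(\<lambda>N. (1 - q) / (1 - q powi k) * ((1 - (q ^ (p ^ N)) powi k) / (1 - q ^ (p ^ N))))
        \<longlonglongrightarrow> (1 - q) / (1 - q powi k) * of_int k"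
      by (intro tendsto_pmult tendsto_const tendsto_powi_quotient q_power_p_power_tendsto_1 qN)
    moreover have "(1 - q) / (1 - q ^ (p ^ N)) * (\<Sum>y<p ^ N. (q powi k) ^ y) =
        (1 - q) / (1 - q powi k) * ((1 - (q ^ (p ^ N)) powi k) / (1 - q ^ (p ^ N)))" for N
    proof -
      have "(\<Sum>y<p ^ N. (q powi k) ^ y) = (1 - (q powi k) ^ (p ^ N)) / (1 - q powi k)"
        using qk by (simp add: one_diff_power_eq)
      moreover have "(q powi k) ^ (p ^ N) = (q ^ (p ^ N)) powi k"
        by (metis power_int_power power_int_power' mult.commute)
      ultimately show ?thesis by simp
    qed
    moreover have "(1 - q) / (1 - q powi k) * of_int k = num_div_qnum q k"
      using False by (simp add: num_div_qnum_def qnum_def qpow_of_int)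
    ultimately show ?thesis
      unfolding sums by simp
  qed
qed

lemma q_integral_exponential_sum:
  assumes "\<And>y. y \<in> Zp \<Longrightarrow> h y = (\<Sum>l\<in>L. d l * qpow q (of_int (k l - 1) * y))"
  shows "q_integrable p q h" "q_integral p q h = (\<Sum>l\<in>L. d l * num_div_qnum q (k l))"
proof -
  have "q_sums p q h N = (\<Sum>l\<in>L. d l * q_sums p q (\<lambda>y. qpow q (of_int (k l - 1) * y)) N)" for N
  proof -
    have "(\<Sum>y = 0..<p ^ N. h (of_nat y) * qpow q (of_nat y)) =
        (\<Sum>y = 0..<p ^ N. \<Sum>l\<in>L. d l * (qpow q (of_int (k l - 1) * of_nat y) * qpow q (of_nat y)))"
      by (simp add: assms sum_distrib_right mult.assoc)
    also have "\<dots> = (\<Sum>l\<in>L. d l * (\<Sum>y = 0..<p ^ N. qpow q (of_int (k l - 1) * of_nat y) * qpow q (of_nat y)))"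
      by (subst sum.swap) (simp add: sum_distrib_left)
    finally show ?thesis
      unfolding q_sums_def by (simp add: sum_distrib_left mult_ac)
  qed
  moreover have "(\<lambda>N. \<Sum>l\<in>L. d l * q_sums p q (\<lambda>y. qpow q (of_int (k l - 1) * y)) N)
      \<longlonglongrightarrow> (\<Sum>l\<in>L. d l * num_div_qnum q (k l))"
    by (intro tendsto_psum tendsto_pmult tendsto_const q_sums_exponential)
  ultimately have "q_sums p q h \<longlonglongrightarrow> (\<Sum>l\<in>L. d l * num_div_qnum q (k l))"
    by presburger
  then show "q_integrable p q h" "q_integral p q h = (\<Sum>l\<in>L. d l * num_div_qnum q (k l))"
    unfolding q_integrable_def q_integral_def by (auto intro: convergentI limI)
qed

text \<open>
  Integrating a variable out replaces its exponential by a constant and leaves a function of the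
  same form with fewer variables, so the formula follows by induction.  The coefficients \<open>c\<close> vary in
  the induction because they absorb the exponential of the outermost variable, which is held fixed
  while the inner integrals are evaluated.  The hypothesis is confined to \<open>p\<close>-adic integers since
  that is where the law of exponents for \<open>qpow\<close> holds and the integrand separates.
\<close>
lemma iter_q_integral_exponential_sum:
  assumes "\<And>X. range X \<subseteq> Zp \<Longrightarrow>
    g X = (\<Sum>l\<in>L. c l * (\<Prod>j = 1..r. qpow q (of_int (k l j - 1) * X j)))"
  shows "iter_q_integrable p q r g \<and>
    iter_q_integral p q r g = (\<Sum>l\<in>L. c l * (\<Prod>j = 1..r. num_div_qnum q (k l j)))"
  using assms
proof (induction r arbitrary: g c)
  case 0
  then show ?case using zero_in_Zp by (simp add: image_subset_iff)
next
  case (Suc r)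
  let ?e = "\<lambda>l y. qpow q (of_int (k l (Suc r) - 1) * y)"
  have inner: "iter_q_integrable p q r (\<lambda>X. g (X(Suc r := y))) \<and>
      iter_q_integral p q r (\<lambda>X. g (X(Suc r := y))) =
        (\<Sum>l\<in>L. c l * ?e l y * (\<Prod>j = 1..r. num_div_qnum q (k l j)))" if y: "y \<in> Zp" for y
  proof (rule Suc.IH)
    fix X :: "nat \<Rightarrow> 'a" assume "range X \<subseteq> Zp"
    then have "range (X(Suc r := y)) \<subseteq> Zp" using y by auto
    then have "g (X(Suc r := y)) =
        (\<Sum>l\<in>L. c l * (\<Prod>j = 1..Suc r. qpow q (of_int (k l j - 1) * (X(Suc r := y)) j)))"
      by (rule Suc.prems)
    also have "\<dots> = (\<Sum>l\<in>L. c l * ?e l y * (\<Prod>j = 1..r. qpow q (of_int (k l j - 1) * X j)))"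
      by (simp add: mult_ac)
    finally show "g (X(Suc r := y)) = \<dots>" .
  qed
  have "iter_q_integral p q r (\<lambda>X. g (X(Suc r := y))) =
        (\<Sum>l\<in>L. c l * (\<Prod>j = 1..r. num_div_qnum q (k l j)) * ?e l y)" if "y \<in> Zp" for y
    using inner[OF that] by (simp add: mult_ac)
  from q_integral_exponential_sum[OF this] inner show ?case
    by (simp add: mult_ac)
qed

text \<open>
  In the \<open>l\<close>-th term of the binomial expansion \<open>X j\<close> receives the exponent \<open>l\<close>, and the weight
  contributes \<open>- (j + 1)\<close>.
\<close>
lemma beta_integrand_exponential_sum:
  assumes x: "x \<in> Zp" and X: "range X \<subseteq> Zp"
  shows "beta_integrand q n r x X =
    (\<Sum>l = 0..n. of_nat (n choose l) * (- 1) ^ l * qpow q (of_nat l * x) / (1 - q) ^ n *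
      (\<Prod>j = 1..r. qpow q (of_int ((int l - int j) - 1) * X j)))"
proof -
  have XZ: "X j \<in> Zp" for j using X by auto
  let ?u = "\<lambda>j. qpow q (X j)"
  have u: "qpow q (x + (\<Sum>j = 1..r. X j)) = qpow q x * (\<Prod>j = 1..r. ?u j)"
    by (simp add: qpow_add qpow_sum x XZ Zp_sum)
  have "- (\<Sum>j = 1..r. of_nat (j + 1) * X j) = (\<Sum>j = 1..r. of_int (- int (j + 1)) * X j)"
    unfolding sum_negf[symmetric] by (intro sum.cong) (auto simp: algebra_simps)
  then have weight: "qpow q (- (\<Sum>j = 1..r. of_nat (j + 1) * X j)) =
      (\<Prod>j = 1..r. ?u j powi (- int (j + 1)))"
    by (simp only: qpow_sum[OF Zp_of_int_mult[OF XZ]] qpow_of_int_mult[OF XZ])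
  have "qnum q (x + (\<Sum>j = 1..r. X j)) ^ n =
      (- (qpow q x * (\<Prod>j = 1..r. ?u j)) + 1) ^ n / (1 - q) ^ n"
    unfolding qnum_def u by (simp add: power_divide)
  also have "(- (qpow q x * (\<Prod>j = 1..r. ?u j)) + 1) ^ n =
      (\<Sum>l = 0..n. of_nat (n choose l) * (- 1) ^ l * qpow q (of_nat l * x) * (\<Prod>j = 1..r. ?u j ^ l))"
    unfolding binomial_ring atMost_atLeast0 qpow_of_nat_mult[OF x]
    by (intro sum.cong refl)
      (simp add: power_minus[of "qpow q x * _"] power_mult_distrib prod_power_distrib mult_ac)
  finally have power: "qnum q (x + (\<Sum>j = 1..r. X j)) ^ n =
      (\<Sum>l = 0..n. of_nat (n choose l) * (- 1) ^ l * qpow q (of_nat l * x) * (\<Prod>j = 1..r. ?u j ^ l)) /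
        (1 - q) ^ n" .
  have "beta_integrand q n r x X =
      (\<Sum>l = 0..n. of_nat (n choose l) * (- 1) ^ l * qpow q (of_nat l * x) / (1 - q) ^ n *
        ((\<Prod>j = 1..r. ?u j ^ l) * (\<Prod>j = 1..r. ?u j powi (- int (j + 1)))))"
    unfolding beta_integrand_def weight power sum_divide_distrib sum_distrib_right
    by (intro sum.cong refl) simp
  moreover have "(\<Prod>j = 1..r. ?u j ^ l) * (\<Prod>j = 1..r. ?u j powi (- int (j + 1))) =
      (\<Prod>j = 1..r. qpow q (of_int ((int l - int j) - 1) * X j))" for l
    unfolding prod.distrib[symmetric] qpow_of_int_mult[OF XZ]
  proof (intro prod.cong refl)
    fix j
    have "?u j ^ l * ?u j powi (- int (j + 1)) = ?u j powi (int l + - int (j + 1))"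
      by (subst power_int_add) (simp_all add: qpow_nonzero XZ)
    then show "?u j ^ l * ?u j powi (- int (j + 1)) = ?u j powi (int l - int j - 1)"
      by (simp add: algebra_simps)
  qed
  ultimately show ?thesis by simp
qed

end

end

end

theorem theorem6:
  fixes p :: nat and q x :: "'a::{field_char_0, complete_space}" and r n :: nat
  assumes "padic_complex_field TYPE('a) p"
    and "pabs (1 - q) < 1"
    and "\<forall>k\<ge>1. q ^ k \<noteq> 1"
    and "r \<ge> 1"
    and "x \<in> Zp"
  shows "iter_q_integrable p q r (beta_integrand q n r x) \<and>
    (1 - q) ^ n * beta0 p q n r x =
      (\<Sum>l = 0..n. of_nat (n choose l) * (-1) ^ l * qpow q (of_nat l * x) *
         binom_ratio q (int l - 1) r)"
proof -
  interpret padic_complex_field "TYPE('a)" p by fact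
  have "q \<noteq> 1"
    using assms(3) by (metis order_refl power_one_right)
  have "iter_q_integrable p q r (beta_integrand q n r x) \<and>
    iter_q_integral p q r (beta_integrand q n r x) =
      (\<Sum>l = 0..n. of_nat (n choose l) * (-1) ^ l * qpow q (of_nat l * x) / (1 - q) ^ n *
         (\<Prod>j = 1..r. num_div_qnum q (int l - int j)))"
    using assms
    by (intro iter_q_integral_exponential_sum beta_integrand_exponential_sum)
  moreover have "binom_ratio q (int l - 1) r = (\<Prod>j = 1..r. num_div_qnum q (int l - int j))" for l
    by (simp add: binom_ratio_def algebra_simps)
  ultimately show ?thesis
    using \<open>q \<noteq> 1\<close> by (simp add: beta0_def sum_distrib_left)
qed

end
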